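(* For all $\alpha,\beta\in(0,1)$, let the tests $\tilde\chi=(\tilde\tau,\tilde d)$, $\hat\chi=(\hat\tau,\hat d)$, $\check\chi=(\check\tau,\check d)$ be designed as described in the context, with any choice of the free parameters. Then, for all $\alpha,\beta\in(0,1)$ (pathwise), $$\tilde\tau,\ \hat\tau,\ \check\tau\ \le\ n^*(\alpha/3,\beta/3),$$ and consequently $$\tilde\tau,\ \hat\tau,\ \check\tau\ \lesssim\ \frac{|\log(\alpha\wedge\beta)|}{C}\quad\text{as }\alpha\wedge\beta\to0,\qquad\text{where } C=\sup_{\kappa\in(J_0,J_1)}\{\psi_0(\kappa)\wedge\psi_1(\kappa)\}.$$
   Context: Setting. Let $X=(X_n)_{n\ge1}$ be a sequence of random elements of a measurable space $(\mathbb S,\mathcal S)$ and $\mathcal F_n=\sigma(X_1,\dots,X_n)$. The distribution of $X$ belongs to a family $\mathcal P$; $\mathcal P_0,\mathcal P_1\subset\mathcal P$ are disjoint, $H_i$ is the hypothesis that this distribution is in $\mathcal P_i$, and $\mathsf P_0\in\mathcal P_0$, $\mathsf P_1\in\mathcal P_1$ are fixed. Test statistic. $T=(T_n)_{n\ge1}$ is a sequence of real-valued statistics, $T_n$ being $\mathcal F_n$-measurable, such that for all $\alpha,\beta\in(0,1)$ there are $n\in\mathbb N$ and $\kappa\in\mathbb R$ with $\mathsf P_0(T_n>\kappa)\le\alpha$ and $\mathsf P_1(T_n\le\kappa)\le\beta$. The smallest such $n$ is denoted $n^*(\alpha,\beta)$, and $\kappa^*(\alpha,\beta)$ denotes any $\kappa$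 satisfying these two inequalities with $n=n^*(\alpha,\beta)$. Standing assumptions. For every $n$, $\mathsf P_0$ and $\mathsf P_1$ are mutually absolutely continuous on $\mathcal F_n$; $\Lambda_n=\log\frac{d\mathsf P_1}{d\mathsf P_0}(\mathcal F_n)$, $\bar\Lambda_n=\Lambda_n/n$. There are $I_0,I_1\in(0,\infty)$ with $\mathsf P_0(\bar\Lambda_n\to-I_0)=\mathsf P_1(\bar\Lambda_n\to I_1)=1$ and, for every $\epsilon>0$, $\sum_n\mathsf P_0(\bar\Lambda_n>-I_0+\epsilon)+\sum_n\mathsf P_1(\bar\Lambda_n\le I_1-\epsilon)<\infty$. There are reals $J_0<J_1$ with $\mathsf P_0(T_n\to J_0)=\mathsf P_1(T_n\to J_1)=1$, and convex lower-semicontinuous functions $\psi_0,\psi_1:\mathbb R\to[0,\infty]$, both finite on $[J_0,J_1]$, with $\psi_0(J_0)=0$, $\psi_0$ strictly increasing on $[J_0,J_1]$, $\psi_1(J_1)=0$, $\psi_1$ strictly decreasing on $[J_0,J_1]$, and for every $\kappa\in(J_0,J_1)$: $\lim_n\frac1n\log\mathsf P_0(T_n>\kappa)=-\psi_0(\kappa)$ and $\lim_n\frac1n\log\mathsf P_1(T_n\le\kappa)=-\psi_1(\kappa)$. Multistage tests. All three have parameters: positive integers $n_0,n_1,N$ with $n_0\vee n_1<N$ and reals $\kappa_0\le\kappa_1$ and $K$. The 4-stage test $\hat\chi$ has in addition an integer $N_0$ with $n_0<N_0<N$ and a real $K_0\le\kappa_1$; the 4-stage test $\check\chi$ has in addition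 an integer $N_1$ with $n_1<N_1<N$ and a real $K_1\ge\kappa_0$. The relevant times ($n_0,n_1,N$ for the 3-stage test $\tilde\chi$; $n_0,n_1,N_0,N$ for $\hat\chi$; $n_0,n_1,N_1,N$ for $\check\chi$) are visited in increasing order until a decision is made: at time $n_0$, stop and accept $H_0$ (decision 0) if $T_{n_0}\le\kappa_0$; at time $n_1$, stop and reject $H_0$ (decision 1) if $T_{n_1}>\kappa_1$; for $\hat\chi$, at time $N_0$, stop and accept $H_0$ if $T_{N_0}\le K_0$; for $\check\chi$, at time $N_1$, stop and reject $H_0$ if $T_{N_1}>K_1$; if no decision has been made before, stop at time $N$ and reject $H_0$ iff $T_N>K$. The number of observations used is $\tilde\tau,\hat\tau,\check\tau$, respectively. Design for given $\alpha,\beta\in(0,1)$ (each threshold is the value of $\kappa^*$ at the same arguments as $n^*$ in the corresponding sample size: $\kappa_i$ goes with $n_i$, $K_i$ with $N_i$, $K$ with $N$). - $\tilde\chi$: $n_0=n^*(\gamma,\beta/2)$, $n_1=n^*(\alpha/2,\delta)$, $N=n^*(\alpha/2,\beta/2)$, with free parameters $\gamma\in(\alpha/2,1)$, $\delta\in(\beta/2,1)$. - $\hat\chi$: $n_0=n^*(\gamma,\beta/3)$, $N_0=n^*(\gamma',\beta/3)$, $n_1=n^*(\alpha/2,\delta)$, $N=n^*(\alpha/2,\beta/3)$, with free parameters $\alpha/2<\gamma'<\gamma<1$, $\delta\in(\beta/3,1)$. - $\check\chi$: $n_0=n^*(\gamma,\beta/2)$, $n_1=n^*(\alpha/3,\delta)$,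 $N_1=n^*(\alpha/3,\delta')$, $N=n^*(\alpha/3,\beta/2)$, with free parameters $\gamma\in(\alpha/3,1)$, $\beta/2<\delta'<\delta<1$. Asymptotic notation. "$\alpha\wedge\beta\to0$" means that at least one of $\alpha,\beta\in(0,1)$ goes to $0$ while the other either goes to $0$ as well or remains fixed. $x\lesssim y$ means $\limsup x/y\le1$ along every sequence of $(\alpha,\beta)$ in this regime (for the random sample sizes: pathwise, uniformly over paths). $x\wedge y=\min\{x,y\}$. *)

theory Defs
  imports "HOL-Probability.Probability"
begin

text \<open>Sequences of observations and statistics are indexed by \<open>n \<ge> 1\<close>; the values at
  index 0 are irrelevant.\<close>

definition obs_sigma :: "'w measure \<Rightarrow> 's measure \<Rightarrow> (nat \<Rightarrow> 'w \<Rightarrow> 's) \<Rightarrow> nat \<Rightarrow> 'w measure" where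
  "obs_sigma Omega S X n =
     sigma (space Omega) (\<Union>i\<in>{1..n}. {X i -` A \<inter> space Omega | A. A \<in> sets S})"

definition law_of :: "'s measure \<Rightarrow> (nat \<Rightarrow> 'w \<Rightarrow> 's) \<Rightarrow> 'w measure \<Rightarrow> (nat \<Rightarrow> 's) measure" where
  "law_of S X P = distr P (Pi\<^sub>M {1..} (\<lambda>_. S)) (\<lambda>\<omega>. \<lambda>n\<in>{1..}. X n \<omega>)"

text \<open>\<open>RN_deriv M N\<close> is the density of \<open>N\<close> with respect to \<open>M\<close>, i.e. \<open>dN/dM\<close>.\<close>

definition log_lik_ratio :: "'w measure \<Rightarrow> 'w measure \<Rightarrow> 'w measure \<Rightarrow> 'w \<Rightarrow> real" where
  "log_lik_ratio P0 P1 F \<omega> =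
     ln (enn2real (RN_deriv (restr_to_subalg P0 F) (restr_to_subalg P1 F) \<omega>))"

definition avg_llr ::
  "'w measure \<Rightarrow> 's measure \<Rightarrow> (nat \<Rightarrow> 'w \<Rightarrow> 's) \<Rightarrow> 'w measure \<Rightarrow> 'w measure \<Rightarrow> nat \<Rightarrow> 'w \<Rightarrow> real" where
  "avg_llr Omega S X P0 P1 n \<omega> = log_lik_ratio P0 P1 (obs_sigma Omega S X n) \<omega> / real n"

definition prob_gt :: "'w measure \<Rightarrow> (nat \<Rightarrow> 'w \<Rightarrow> real) \<Rightarrow> nat \<Rightarrow> real \<Rightarrow> real" where
  "prob_gt P T n \<kappa> = measure P {\<omega> \<in> space P. T n \<omega> > \<kappa>}"

definition prob_le :: "'w measure \<Rightarrow> (nat \<Rightarrow> 'w \<Rightarrow> real) \<Rightarrow> nat \<Rightarrow> real \<Rightarrow> real" where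
  "prob_le P T n \<kappa> = measure P {\<omega> \<in> space P. T n \<omega> \<le> \<kappa>}"

definition nstar ::
  "'w measure \<Rightarrow> 'w measure \<Rightarrow> (nat \<Rightarrow> 'w \<Rightarrow> real) \<Rightarrow> real \<Rightarrow> real \<Rightarrow> nat" where
  "nstar P0 P1 T \<alpha> \<beta> = (LEAST n. 1 \<le> n \<and> (\<exists>\<kappa>. prob_gt P0 T n \<kappa> \<le> \<alpha> \<and> prob_le P1 T n \<kappa> \<le> \<beta>))"

text \<open>The threshold \<open>\<kappa>\<^sup>*(\<alpha>,\<beta>)\<close> is any element of the following set.\<close>

definition kappa_star ::
  "'w measure \<Rightarrow> 'w measure \<Rightarrow> (nat \<Rightarrow> 'w \<Rightarrow> real) \<Rightarrow> real \<Rightarrow> real \<Rightarrow> real set" where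
  "kappa_star P0 P1 T \<alpha> \<beta> =
     {\<kappa>. prob_gt P0 T (nstar P0 P1 T \<alpha> \<beta>) \<kappa> \<le> \<alpha> \<and> prob_le P1 T (nstar P0 P1 T \<alpha> \<beta>) \<kappa> \<le> \<beta>}"

text \<open>For nonnegative functions the right-hand side never involves \<open>\<infinity> - \<infinity>\<close>.\<close>

definition convex_ext :: "(real \<Rightarrow> ereal) \<Rightarrow> bool" where
  "convex_ext f \<longleftrightarrow>
     (\<forall>x y. \<forall>t\<in>{0<..<1}. f ((1 - t) * x + t * y) \<le> ereal (1 - t) * f x + ereal t * f y)"

definition lower_semicont :: "(real \<Rightarrow> ereal) \<Rightarrow> bool" where
  "lower_semicont f \<longleftrightarrow> (\<forall>x. f x \<le> Liminf (at x) f)"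

text \<open>The convention \<open>log 0 = -\<infinity>\<close> matters here, since \<open>ln 0 = 0\<close> in the library.\<close>

definition log_ext :: "real \<Rightarrow> ereal" where
  "log_ext p = (if p = 0 then - \<infinity> else ereal (ln p))"

locale testing_problem =
  fixes Omega :: "'w measure" and S :: "'s measure" and X :: "nat \<Rightarrow> 'w \<Rightarrow> 's"
    and Laws H0 H1 :: "(nat \<Rightarrow> 's) measure set"
    and P0 P1 :: "'w measure"
  assumes X_measurable: "\<And>n. 1 \<le> n \<Longrightarrow> X n \<in> measurable Omega S"
    and Laws_prob: "\<And>Q. Q \<in> Laws \<Longrightarrow> prob_space Q \<and> sets Q = sets (Pi\<^sub>M {1..} (\<lambda>_. S))"
    and hypotheses: "H0 \<subseteq> Laws" "H1 \<subseteq> Laws" "H0 \<inter> H1 = {}"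
    and P0_prob: "prob_space P0" "sets P0 = sets Omega"
    and P1_prob: "prob_space P1" "sets P1 = sets Omega"
    and P0_law: "law_of S X P0 \<in> H0"
    and P1_law: "law_of S X P1 \<in> H1"

locale test_statistic = testing_problem Omega S X Laws H0 H1 P0 P1
  for Omega :: "'w measure" and S :: "'s measure" and X :: "nat \<Rightarrow> 'w \<Rightarrow> 's"
    and Laws H0 H1 :: "(nat \<Rightarrow> 's) measure set" and P0 P1 :: "'w measure" +
  fixes T :: "nat \<Rightarrow> 'w \<Rightarrow> real"
  assumes T_measurable: "\<And>n. 1 \<le> n \<Longrightarrow> T n \<in> borel_measurable (obs_sigma Omega S X n)"
    and errors_controllable:
      "\<And>\<alpha> \<beta>. \<alpha> \<in> {0<..<1} \<Longrightarrow> \<beta> \<in> {0<..<1} \<Longrightarrow>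
        \<exists>n\<ge>1. \<exists>\<kappa>. prob_gt P0 T n \<kappa> \<le> \<alpha> \<and> prob_le P1 T n \<kappa> \<le> \<beta>"

locale standing_assumptions = test_statistic Omega S X Laws H0 H1 P0 P1 T
  for Omega :: "'w measure" and S :: "'s measure" and X :: "nat \<Rightarrow> 'w \<Rightarrow> 's"
    and Laws H0 H1 :: "(nat \<Rightarrow> 's) measure set" and P0 P1 :: "'w measure"
    and T :: "nat \<Rightarrow> 'w \<Rightarrow> real" +
  fixes I0 I1 J0 J1 :: real and \<psi>0 \<psi>1 :: "real \<Rightarrow> ereal"
  assumes mutually_abs_cont:
      "\<And>n. 1 \<le> n \<Longrightarrow> absolutely_continuous
         (restr_to_subalg P0 (obs_sigma Omega S X n)) (restr_to_subalg P1 (obs_sigma Omega S X n))"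
      "\<And>n. 1 \<le> n \<Longrightarrow> absolutely_continuous
         (restr_to_subalg P1 (obs_sigma Omega S X n)) (restr_to_subalg P0 (obs_sigma Omega S X n))"
    and I_pos: "0 < I0" "0 < I1"
    and llr_limit0: "AE \<omega> in P0. (\<lambda>n. avg_llr Omega S X P0 P1 n \<omega>) \<longlonglongrightarrow> - I0"
    and llr_limit1: "AE \<omega> in P1. (\<lambda>n. avg_llr Omega S X P0 P1 n \<omega>) \<longlonglongrightarrow> I1"
    and llr_complete0: "\<And>\<epsilon>. \<epsilon> > 0 \<Longrightarrow>
      summable (\<lambda>n. measure P0 {\<omega> \<in> space P0. avg_llr Omega S X P0 P1 n \<omega> > - I0 + \<epsilon>})"
    and llr_complete1: "\<And>\<epsilon>. \<epsilon> > 0 \<Longrightarrow>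
      summable (\<lambda>n. measure P1 {\<omega> \<in> space P1. avg_llr Omega S X P0 P1 n \<omega> \<le> I1 - \<epsilon>})"
    and J_less: "J0 < J1"
    and T_limit0: "AE \<omega> in P0. (\<lambda>n. T n \<omega>) \<longlonglongrightarrow> J0"
    and T_limit1: "AE \<omega> in P1. (\<lambda>n. T n \<omega>) \<longlonglongrightarrow> J1"
    and psi0_nonneg: "\<And>\<kappa>. 0 \<le> \<psi>0 \<kappa>" and psi1_nonneg: "\<And>\<kappa>. 0 \<le> \<psi>1 \<kappa>"
    and psi0_convex: "convex_ext \<psi>0" and psi1_convex: "convex_ext \<psi>1"
    and psi0_lsc: "lower_semicont \<psi>0" and psi1_lsc: "lower_semicont \<psi>1"
    and psi0_finite: "\<And>\<kappa>. \<kappa> \<in> {J0..J1} \<Longrightarrow> \<psi>0 \<kappa> < \<infinity>"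
    and psi1_finite: "\<And>\<kappa>. \<kappa> \<in> {J0..J1} \<Longrightarrow> \<psi>1 \<kappa> < \<infinity>"
    and psi0_zero: "\<psi>0 J0 = 0" and psi1_zero: "\<psi>1 J1 = 0"
    and psi0_mono: "strict_mono_on {J0..J1} \<psi>0"
    and psi1_antimono: "strict_antimono_on {J0..J1} \<psi>1"
    and psi0_rate: "\<And>\<kappa>. \<kappa> \<in> {J0<..<J1} \<Longrightarrow>
      (\<lambda>n. ereal (1 / real n) * log_ext (prob_gt P0 T n \<kappa>)) \<longlonglongrightarrow> - \<psi>0 \<kappa>"
    and psi1_rate: "\<And>\<kappa>. \<kappa> \<in> {J0<..<J1} \<Longrightarrow>
      (\<lambda>n. ereal (1 / real n) * log_ext (prob_le P1 T n \<kappa>)) \<longlonglongrightarrow> - \<psi>1 \<kappa>"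

definition chernoff_C :: "real \<Rightarrow> real \<Rightarrow> (real \<Rightarrow> ereal) \<Rightarrow> (real \<Rightarrow> ereal) \<Rightarrow> ereal" where
  "chernoff_C J0 J1 \<psi>0 \<psi>1 = (SUP \<kappa>\<in>{J0<..<J1}. min (\<psi>0 \<kappa>) (\<psi>1 \<kappa>))"

text \<open>A rule maps a time \<open>n\<close> and the value of \<open>T\<^sub>n\<close> to \<open>None\<close> (continue) or \<open>Some d\<close> (stop
  with decision \<open>d\<close>: 0 accepts and 1 rejects \<open>H\<^sub>0\<close>). A rule is always \<open>None\<close> at irrelevant
  times, so the least time at which it is not \<open>None\<close> is the first relevant time, visited in
  increasing order, at which a decision is made.\<close>

type_synonym rule = "nat \<Rightarrow> real \<Rightarrow> nat option"

definition stop_time :: "(nat \<Rightarrow> 'w \<Rightarrow> real) \<Rightarrow> rule \<Rightarrow> 'w \<Rightarrow> nat" where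
  "stop_time T r \<omega> = (LEAST n. r n (T n \<omega>) \<noteq> None)"

definition decision :: "(nat \<Rightarrow> 'w \<Rightarrow> real) \<Rightarrow> rule \<Rightarrow> 'w \<Rightarrow> nat" where
  "decision T r \<omega> = the (r (stop_time T r \<omega>) (T (stop_time T r \<omega>) \<omega>))"

definition test_of :: "(nat \<Rightarrow> 'w \<Rightarrow> real) \<Rightarrow> rule \<Rightarrow> ('w \<Rightarrow> nat) \<times> ('w \<Rightarrow> nat)" where
  "test_of T r = (stop_time T r, decision T r)"

text \<open>When \<open>max n\<^sub>0 n\<^sub>1 < N\<close>, \<open>n\<^sub>0 < N\<^sub>0 < N\<close>, \<open>n\<^sub>1 < N\<^sub>1 < N\<close>, \<open>\<kappa>\<^sub>0 \<le> \<kappa>\<^sub>1\<close>, \<open>K\<^sub>0 \<le> \<kappa>\<^sub>1\<close> and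
  \<open>\<kappa>\<^sub>0 \<le> K\<^sub>1\<close>, the conditions below never conflict and their order is immaterial. For other
  parameters (a design may, e.g., give \<open>n\<^sub>0 = N\<close>) the rules still define tests, coinciding
  stages being resolved in favour of the earlier clause. The ordering constraints are therefore
  not imposed on the designs, which thus include all those satisfying them.\<close>

definition tilde_rule :: "nat \<Rightarrow> nat \<Rightarrow> nat \<Rightarrow> real \<Rightarrow> real \<Rightarrow> real \<Rightarrow> rule" where
  "tilde_rule n0 n1 N \<kappa>0 \<kappa>1 K n x =
     (if n = n0 \<and> x \<le> \<kappa>0 then Some 0
      else if n = n1 \<and> x > \<kappa>1 then Some 1
      else if n = N then Some (if x > K then 1 else 0)
      else None)"

definition hat_rule ::
  "nat \<Rightarrow> nat \<Rightarrow> nat \<Rightarrow> nat \<Rightarrow> real \<Rightarrow> real \<Rightarrow> real \<Rightarrow> real \<Rightarrow> rule" where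
  "hat_rule n0 n1 N0 N \<kappa>0 \<kappa>1 K0 K n x =
     (if n = n0 \<and> x \<le> \<kappa>0 then Some 0
      else if n = n1 \<and> x > \<kappa>1 then Some 1
      else if n = N0 \<and> x \<le> K0 then Some 0
      else if n = N then Some (if x > K then 1 else 0)
      else None)"

definition check_rule ::
  "nat \<Rightarrow> nat \<Rightarrow> nat \<Rightarrow> nat \<Rightarrow> real \<Rightarrow> real \<Rightarrow> real \<Rightarrow> real \<Rightarrow> rule" where
  "check_rule n0 n1 N1 N \<kappa>0 \<kappa>1 K1 K n x =
     (if n = n0 \<and> x \<le> \<kappa>0 then Some 0
      else if n = n1 \<and> x > \<kappa>1 then Some 1
      else if n = N1 \<and> x > K1 then Some 1
      else if n = N then Some (if x > K then 1 else 0)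
      else None)"

text \<open>The sets of all tests that the designs for \<open>\<alpha>, \<beta>\<close> can produce, over all choices of the
  free parameters and of the thresholds \<open>\<kappa>\<^sup>*\<close>.\<close>

definition tilde_tests ::
  "'w measure \<Rightarrow> 'w measure \<Rightarrow> (nat \<Rightarrow> 'w \<Rightarrow> real) \<Rightarrow> real \<Rightarrow> real \<Rightarrow>
     (('w \<Rightarrow> nat) \<times> ('w \<Rightarrow> nat)) set" where
  "tilde_tests P0 P1 T \<alpha> \<beta> =
     {test_of T
        (tilde_rule (nstar P0 P1 T \<gamma> (\<beta>/2)) (nstar P0 P1 T (\<alpha>/2) \<delta>) (nstar P0 P1 T (\<alpha>/2) (\<beta>/2))
          \<kappa>0 \<kappa>1 K) | \<gamma> \<delta> \<kappa>0 \<kappa>1 K.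
        \<alpha>/2 < \<gamma> \<and> \<gamma> < 1 \<and> \<beta>/2 < \<delta> \<and> \<delta> < 1 \<and>
        \<kappa>0 \<in> kappa_star P0 P1 T \<gamma> (\<beta>/2) \<and>
        \<kappa>1 \<in> kappa_star P0 P1 T (\<alpha>/2) \<delta> \<and>
        K \<in> kappa_star P0 P1 T (\<alpha>/2) (\<beta>/2)}"

definition hat_tests ::
  "'w measure \<Rightarrow> 'w measure \<Rightarrow> (nat \<Rightarrow> 'w \<Rightarrow> real) \<Rightarrow> real \<Rightarrow> real \<Rightarrow>
     (('w \<Rightarrow> nat) \<times> ('w \<Rightarrow> nat)) set" where
  "hat_tests P0 P1 T \<alpha> \<beta> =
     {test_of T
        (hat_rule (nstar P0 P1 T \<gamma> (\<beta>/3)) (nstar P0 P1 T (\<alpha>/2) \<delta>)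
          (nstar P0 P1 T \<gamma>' (\<beta>/3)) (nstar P0 P1 T (\<alpha>/2) (\<beta>/3))
          \<kappa>0 \<kappa>1 K0 K) | \<gamma> \<gamma>' \<delta> \<kappa>0 \<kappa>1 K0 K.
        \<alpha>/2 < \<gamma>' \<and> \<gamma>' < \<gamma> \<and> \<gamma> < 1 \<and> \<beta>/3 < \<delta> \<and> \<delta> < 1 \<and>
        \<kappa>0 \<in> kappa_star P0 P1 T \<gamma> (\<beta>/3) \<and>
        \<kappa>1 \<in> kappa_star P0 P1 T (\<alpha>/2) \<delta> \<and>
        K0 \<in> kappa_star P0 P1 T \<gamma>' (\<beta>/3) \<and>
        K \<in> kappa_star P0 P1 T (\<alpha>/2) (\<beta>/3)}"

definition check_tests ::
  "'w measure \<Rightarrow> 'w measure \<Rightarrow> (nat \<Rightarrow> 'w \<Rightarrow> real) \<Rightarrow> real \<Rightarrow> real \<Rightarrow>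
     (('w \<Rightarrow> nat) \<times> ('w \<Rightarrow> nat)) set" where
  "check_tests P0 P1 T \<alpha> \<beta> =
     {test_of T
        (check_rule (nstar P0 P1 T \<gamma> (\<beta>/2)) (nstar P0 P1 T (\<alpha>/3) \<delta>)
          (nstar P0 P1 T (\<alpha>/3) \<delta>') (nstar P0 P1 T (\<alpha>/3) (\<beta>/2))
          \<kappa>0 \<kappa>1 K1 K) | \<gamma> \<delta> \<delta>' \<kappa>0 \<kappa>1 K1 K.
        \<alpha>/3 < \<gamma> \<and> \<gamma> < 1 \<and> \<beta>/2 < \<delta>' \<and> \<delta>' < \<delta> \<and> \<delta> < 1 \<and>
        \<kappa>0 \<in> kappa_star P0 P1 T \<gamma> (\<beta>/2) \<and>
        \<kappa>1 \<in> kappa_star P0 P1 T (\<alpha>/3) \<delta> \<and>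
        K1 \<in> kappa_star P0 P1 T (\<alpha>/3) \<delta>' \<and>
        K \<in> kappa_star P0 P1 T (\<alpha>/3) (\<beta>/2)}"

definition vanishing_regime :: "(nat \<Rightarrow> real) \<Rightarrow> (nat \<Rightarrow> real) \<Rightarrow> bool" where
  "vanishing_regime a b \<longleftrightarrow>
     (\<forall>k. a k \<in> {0<..<1} \<and> b k \<in> {0<..<1}) \<and>
     (a \<longlonglongrightarrow> 0 \<and> b \<longlonglongrightarrow> 0 \<or>
      a \<longlonglongrightarrow> 0 \<and> (\<exists>\<beta>. \<forall>k. b k = \<beta>) \<or>
      (\<exists>\<alpha>. \<forall>k. a k = \<alpha>) \<and> b \<longlonglongrightarrow> 0)"

text \<open>\<open>x \<lesssim> y\<close> along a sequence, uniformly over the paths \<open>\<omega> \<in> W\<close>.\<close>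

definition asymp_le_unif :: "'w set \<Rightarrow> (nat \<Rightarrow> 'w \<Rightarrow> nat) \<Rightarrow> (nat \<Rightarrow> ereal) \<Rightarrow> bool" where
  "asymp_le_unif W x y \<longleftrightarrow> limsup (\<lambda>k. SUP \<omega>\<in>W. ereal (real (x k \<omega>)) / y k) \<le> 1"

end

theory Submission
  imports Defs
begin

text \<open>All three tests stop no later than their last stage, because there a decision is always
  made. The last stage is a value of \<open>nstar\<close> whose error levels are at least \<open>\<alpha>/3\<close> and \<open>\<beta>/3\<close>, so
  it is at most \<open>nstar (\<alpha>/3) (\<beta>/3)\<close> because \<open>nstar\<close> is nonincreasing in each level.

  For the asymptotics, let \<open>c\<close> be smaller than the supremum \<open>C\<close> and choose one threshold \<open>\<kappa>\<close> at
  which both exponential rates exceed \<open>c\<close>. With this fixed \<open>\<kappa>\<close> both error probabilities are at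
  most \<open>exp (- c n)\<close> for all large \<open>n\<close>, so that \<open>n \<approx> \<bar>ln (min \<alpha> \<beta> / 3)\<bar> / c\<close> observations already
  achieve the levels \<open>\<alpha>/3\<close> and \<open>\<beta>/3\<close>. The minimality of \<open>nstar\<close> turns this into
  \<open>nstar (\<alpha>/3) (\<beta>/3) \<le> \<bar>ln (min \<alpha> \<beta>)\<bar> / c + D\<close> with \<open>D\<close> independent of the levels
  (lemma \<open>nstar_third_le\<close>). Dividing by \<open>\<bar>ln (min \<alpha> \<beta>)\<bar> / C\<close>, letting \<open>min \<alpha> \<beta>\<close> tend to 0 and
  then \<open>c\<close> tend to \<open>C\<close> gives the claim; this needs \<open>0 < C < \<infinity>\<close>, which holds because \<open>\<psi>0\<close> and
  \<open>\<psi>1\<close> are positive inside the interval and bounded by their values at its ends.\<close>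

section \<open>Stopping times and sample sizes as least elements\<close>

lemma stop_time_le:
  assumes "r N (T N \<omega>) \<noteq> None"
  shows "stop_time T r \<omega> \<le> N"
  unfolding stop_time_def using assms by (rule Least_le)

lemma nstar_le:
  assumes "1 \<le> n" "prob_gt P0 T n \<kappa> \<le> \<alpha>" "prob_le P1 T n \<kappa> \<le> \<beta>"
  shows "nstar P0 P1 T \<alpha> \<beta> \<le> n"
  unfolding nstar_def by (rule Least_le) (use assms in blast)

section \<open>From affine bounds to first-order asymptotics\<close>

text \<open>The part of the asymptotic statement that does not involve probability: the affine bound
  for every slope \<open>1 / c\<close> with \<open>c < C\<close> determines the first-order behaviour.\<close>

lemma asymp_le_unif_if_affine_bound:
  fixes L :: "nat \<Rightarrow> real" and C :: real
  assumes "0 < C" and Lpos: "\<And>k. 0 < L k" and Llim: "filterlim L at_top sequentially"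
    and bound: "\<And>c. 0 < c \<Longrightarrow> c < C \<Longrightarrow>
      \<exists>D. \<forall>k. \<forall>\<omega>\<in>W. real (x k \<omega>) \<le> L k / c + D"
  shows "asymp_le_unif W x (\<lambda>k. ereal (L k) / ereal C)"
  unfolding asymp_le_unif_def
proof (rule ereal_le_epsilon2)
  fix e :: real
  assume e: "0 < e"
  define c where "c = C / (1 + e)"
  have c: "0 < c" "c < C" and Cc: "C / c = 1 + e"
    using e \<open>0 < C\<close> by (auto simp: c_def field_simps)
  obtain D where D: "\<And>k \<omega>. \<omega> \<in> W \<Longrightarrow> real (x k \<omega>) \<le> L k / c + D"
    using bound[OF c] by blast
  have "(SUP \<omega>\<in>W. ereal (real (x k \<omega>)) / (ereal (L k) / ereal C)) \<le> ereal (1 + e + D * C / L k)"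
    for k
  proof (rule SUP_least)
    fix \<omega> assume "\<omega> \<in> W"
    have "real (x k \<omega>) / (L k / C) \<le> (L k / c + D) / (L k / C)"
      by (rule divide_right_mono) (use D[OF \<open>\<omega> \<in> W\<close>] Lpos[of k] \<open>0 < C\<close> in auto)
    also have "\<dots> = C / c + D * C / L k"
      using Lpos[of k] \<open>0 < C\<close> c by (simp add: field_simps)
    finally show "ereal (real (x k \<omega>)) / (ereal (L k) / ereal C) \<le> ereal (1 + e + D * C / L k)"
      using Lpos[of k] \<open>0 < C\<close> by (simp add: Cc)
  qed
  then have "limsup (\<lambda>k. SUP \<omega>\<in>W. ereal (real (x k \<omega>)) / (ereal (L k) / ereal C))
      \<le> limsup (\<lambda>k. ereal (1 + e + D * C / L k))"
    by (intro Limsup_mono always_eventually allI)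
  also have "\<dots> = ereal (1 + e)"
  proof (rule lim_imp_Limsup)
    have "(\<lambda>k. 1 + e + D * C / L k) \<longlonglongrightarrow> 1 + e + 0"
      by (intro tendsto_intros tendsto_divide_0[OF tendsto_const]
          filterlim_at_top_imp_at_infinity Llim)
    then show "(\<lambda>k. ereal (1 + e + D * C / L k)) \<longlonglongrightarrow> ereal (1 + e)"
      by simp
  qed simp
  also have "ereal (1 + e) = 1 + ereal e"
    by simp
  finally show "limsup (\<lambda>k. SUP \<omega>\<in>W. ereal (real (x k \<omega>)) / (ereal (L k) / ereal C))
      \<le> 1 + ereal e" .
qed

lemma vanishing_regime_levels:
  assumes "vanishing_regime a b"
  shows "a k \<in> {0<..<1}" "b k \<in> {0<..<1}"
  using assms unfolding vanishing_regime_def by blast+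

lemma vanishing_regime_min:
  assumes "vanishing_regime a b"
  shows "0 < min (a k) (b k)" "min (a k) (b k) < 1"
    and "filterlim (\<lambda>k. \<bar>ln (min (a k) (b k))\<bar>) at_top sequentially"
proof -
  have ab: "0 < a k" "a k < 1" "0 < b k" "b k < 1" for k
    using vanishing_regime_levels[OF assms, of k] by auto
  show "0 < min (a k) (b k)" "min (a k) (b k) < 1"
    using ab[of k] by auto
  from assms have "a \<longlonglongrightarrow> 0 \<or> b \<longlonglongrightarrow> 0"
    by (auto simp: vanishing_regime_def)
  then have "(\<lambda>k. min (a k) (b k)) \<longlonglongrightarrow> 0"
  proof
    assume "a \<longlonglongrightarrow> 0"
    then show ?thesis
      by (rule tendsto_sandwich[rotated 3, where f = "\<lambda>_. 0"])
        (use ab in \<open>auto intro!: always_eventually simp: less_imp_le\<close>)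
  next
    assume "b \<longlonglongrightarrow> 0"
    then show ?thesis
      by (rule tendsto_sandwich[rotated 3, where f = "\<lambda>_. 0"])
        (use ab in \<open>auto intro!: always_eventually simp: less_imp_le\<close>)
  qed
  then have "filterlim (\<lambda>k. min (a k) (b k)) (at_right 0) sequentially"
    using ab by (simp add: filterlim_at order_less_imp_not_eq2)
  then have "filterlim (\<lambda>k. ln (min (a k) (b k))) at_bot sequentially"
    by (rule filterlim_compose[OF ln_at_0])
  then have "filterlim (\<lambda>k. - ln (min (a k) (b k))) at_top sequentially"
    by (simp add: filterlim_uminus_at_top)
  then show "filterlim (\<lambda>k. \<bar>ln (min (a k) (b k))\<bar>) at_top sequentially"
    by (rule filterlim_at_top_mono) (intro always_eventually allI abs_ge_minus_self)
qed

section \<open>The bound on the stopping times\<close>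

context test_statistic
begin

lemma nstar_antimono:
  assumes "\<alpha>' \<in> {0<..<1}" "\<beta>' \<in> {0<..<1}" "\<alpha>' \<le> \<alpha>" "\<beta>' \<le> \<beta>"
  shows "nstar P0 P1 T \<alpha> \<beta> \<le> nstar P0 P1 T \<alpha>' \<beta>'"
proof -
  let ?n = "nstar P0 P1 T \<alpha>' \<beta>'"
  have "1 \<le> ?n \<and> (\<exists>\<kappa>. prob_gt P0 T ?n \<kappa> \<le> \<alpha>' \<and> prob_le P1 T ?n \<kappa> \<le> \<beta>')"
    unfolding nstar_def by (rule LeastI_ex) (use errors_controllable[OF assms(1,2)] in blast)
  then obtain \<kappa> where "1 \<le> ?n" "prob_gt P0 T ?n \<kappa> \<le> \<alpha>'" "prob_le P1 T ?n \<kappa> \<le> \<beta>'"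
    by blast
  then show ?thesis
    using assms(3,4) by (intro nstar_le[where \<kappa> = \<kappa>]) auto
qed

lemma multistage_tau_le:
  assumes "\<alpha> \<in> {0<..<1}" "\<beta> \<in> {0<..<1}"
    and "(\<tau>, d) \<in> tilde_tests P0 P1 T \<alpha> \<beta> \<union> hat_tests P0 P1 T \<alpha> \<beta> \<union> check_tests P0 P1 T \<alpha> \<beta>"
  shows "\<tau> \<omega> \<le> nstar P0 P1 T (\<alpha>/3) (\<beta>/3)"
proof -
  have last_stage: "stop_time T r \<omega> \<le> nstar P0 P1 T (\<alpha>/3) (\<beta>/3)"
    if "r (nstar P0 P1 T \<alpha>' \<beta>') (T (nstar P0 P1 T \<alpha>' \<beta>') \<omega>) \<noteq> None" "\<alpha>/3 \<le> \<alpha>'" "\<beta>/3 \<le> \<beta>'"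
    for r \<alpha>' \<beta>'
  proof -
    have "stop_time T r \<omega> \<le> nstar P0 P1 T \<alpha>' \<beta>'"
      by (rule stop_time_le) (rule that(1))
    also have "\<dots> \<le> nstar P0 P1 T (\<alpha>/3) (\<beta>/3)"
      using assms(1,2) that(2,3) by (intro nstar_antimono) auto
    finally show ?thesis .
  qed
  from assms(3) consider "(\<tau>, d) \<in> tilde_tests P0 P1 T \<alpha> \<beta>"
    | "(\<tau>, d) \<in> hat_tests P0 P1 T \<alpha> \<beta>" | "(\<tau>, d) \<in> check_tests P0 P1 T \<alpha> \<beta>"
    by blast
  then show ?thesis
  proof cases
    case 1
    then show ?thesis
      using assms(1,2) unfolding tilde_tests_def test_of_def
      by (auto intro!: last_stage[where \<alpha>' = "\<alpha>/2" and \<beta>' = "\<beta>/2"] simp: tilde_rule_def)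
  next
    case 2
    then show ?thesis
      using assms(1,2) unfolding hat_tests_def test_of_def
      by (auto intro!: last_stage[where \<alpha>' = "\<alpha>/2" and \<beta>' = "\<beta>/3"] simp: hat_rule_def)
  next
    case 3
    then show ?thesis
      using assms(1,2) unfolding check_tests_def test_of_def
      by (auto intro!: last_stage[where \<alpha>' = "\<alpha>/3" and \<beta>' = "\<beta>/2"] simp: check_rule_def)
  qed
qed

end

section \<open>Asymptotics of the sample size\<close>

context standing_assumptions
begin

lemma chernoff_C_pos_finite:
  obtains C where "0 < C" "chernoff_C J0 J1 \<psi>0 \<psi>1 = ereal C"
proof -
  define \<kappa> where "\<kappa> = (J0 + J1) / 2"
  have \<kappa>: "J0 < \<kappa>" "\<kappa> < J1"
    using J_less by (auto simp: \<kappa>_def)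
  have "\<psi>0 J0 < \<psi>0 \<kappa>" "\<psi>1 J1 < \<psi>1 \<kappa>"
    using psi0_mono psi1_antimono \<kappa> by (auto simp: monotone_on_def)
  then have "0 < min (\<psi>0 \<kappa>) (\<psi>1 \<kappa>)"
    by (simp add: psi0_zero psi1_zero)
  also have "\<dots> \<le> chernoff_C J0 J1 \<psi>0 \<psi>1"
    unfolding chernoff_C_def by (rule SUP_upper) (use \<kappa> in simp)
  finally have pos: "0 < chernoff_C J0 J1 \<psi>0 \<psi>1" .
  have "chernoff_C J0 J1 \<psi>0 \<psi>1 \<le> \<psi>0 J1"
    unfolding chernoff_C_def
  proof (rule SUP_least)
    fix \<kappa>' assume "\<kappa>' \<in> {J0<..<J1}"
    then have "\<psi>0 \<kappa>' < \<psi>0 J1"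
      using psi0_mono by (auto simp: monotone_on_def)
    then show "min (\<psi>0 \<kappa>') (\<psi>1 \<kappa>') \<le> \<psi>0 J1"
      by (simp add: min.coboundedI1)
  qed
  also have "\<dots> < \<infinity>"
    using psi0_finite J_less by simp
  finally show ?thesis
    using pos that by (cases "chernoff_C J0 J1 \<psi>0 \<psi>1") auto
qed

text \<open>For \<open>p = 0\<close> the hypothesis reads \<open>- \<infinity> < - c\<close> and carries no information, but the bound
  is then trivial; a vanishing error probability therefore needs no special treatment later.\<close>

lemma le_exp_if_log_ext_rate:
  assumes "1 \<le> n" "0 \<le> p" "ereal (1 / real n) * log_ext p < ereal (- c)"
  shows "p \<le> exp (- (c * real n))"
proof (cases "p = 0")
  case False
  with assms have "ln p / real n < - c"
    by (simp add: log_ext_def)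
  with assms(1) have "ln p < - (c * real n)"
    by (simp add: field_simps)
  with assms(2) False have "p < exp (- (c * real n))"
    by (metis exp_less_mono exp_ln order_le_less)
  then show ?thesis by simp
qed simp

text \<open>A single threshold serves all \<open>n\<close>: since \<open>c\<close> is below the supremum, some \<open>\<kappa>\<close> has both rates
  above \<open>c\<close>.\<close>

lemma errors_exponentially_small:
  assumes "ereal c < chernoff_C J0 J1 \<psi>0 \<psi>1"
  shows "\<exists>m \<kappa>. 1 \<le> m \<and> (\<forall>n\<ge>m.
    prob_gt P0 T n \<kappa> \<le> exp (- (c * real n)) \<and> prob_le P1 T n \<kappa> \<le> exp (- (c * real n)))"
proof -
  from assms obtain \<kappa> where \<kappa>: "\<kappa> \<in> {J0<..<J1}" and c: "ereal c < \<psi>0 \<kappa>" "ereal c < \<psi>1 \<kappa>"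
    by (auto simp: chernoff_C_def less_SUP_iff)
  from c have "- \<psi>0 \<kappa> < ereal (- c)" "- \<psi>1 \<kappa> < ereal (- c)"
    by (simp_all add: ereal_uminus_less_reorder flip: uminus_ereal.simps(1))
  then have "\<forall>\<^sub>F n in sequentially. ereal (1 / real n) * log_ext (prob_gt P0 T n \<kappa>) < ereal (- c)"
    "\<forall>\<^sub>F n in sequentially. ereal (1 / real n) * log_ext (prob_le P1 T n \<kappa>) < ereal (- c)"
    using order_tendstoD(2)[OF psi0_rate[OF \<kappa>]] order_tendstoD(2)[OF psi1_rate[OF \<kappa>]] by auto
  then have "\<forall>\<^sub>F n in sequentially. 1 \<le> n \<and>
      ereal (1 / real n) * log_ext (prob_gt P0 T n \<kappa>) < ereal (- c) \<and>
      ereal (1 / real n) * log_ext (prob_le P1 T n \<kappa>) < ereal (- c)"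
    using eventually_ge_at_top[of "1::nat"] by eventually_elim simp
  then obtain m where m: "\<And>n. m \<le> n \<Longrightarrow> 1 \<le> n \<and>
      ereal (1 / real n) * log_ext (prob_gt P0 T n \<kappa>) < ereal (- c) \<and>
      ereal (1 / real n) * log_ext (prob_le P1 T n \<kappa>) < ereal (- c)"
    by (auto simp: eventually_sequentially)
  show ?thesis
  proof (intro exI[of _ m] exI[of _ \<kappa>] conjI allI impI)
    show "1 \<le> m" using m[OF order_refl] by simp
    fix n assume "m \<le> n"
    from m[OF this] show "prob_gt P0 T n \<kappa> \<le> exp (- (c * real n))"
      and "prob_le P1 T n \<kappa> \<le> exp (- (c * real n))"
      by (auto intro!: le_exp_if_log_ext_rate simp: prob_gt_def prob_le_def)
  qed
qed

lemma nstar_third_le: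
  assumes "0 < c" "ereal c < chernoff_C J0 J1 \<psi>0 \<psi>1"
  shows "\<exists>D. \<forall>\<alpha>\<in>{0<..<1}. \<forall>\<beta>\<in>{0<..<1}.
    real (nstar P0 P1 T (\<alpha>/3) (\<beta>/3)) \<le> \<bar>ln (min \<alpha> \<beta>)\<bar> / c + D"
proof -
  obtain m \<kappa> where m: "1 \<le> m"
    and gt: "\<And>n. m \<le> n \<Longrightarrow> prob_gt P0 T n \<kappa> \<le> exp (- (c * real n))"
    and le: "\<And>n. m \<le> n \<Longrightarrow> prob_le P1 T n \<kappa> \<le> exp (- (c * real n))"
    using errors_exponentially_small[OF assms(2)] by auto
  show ?thesis
  proof (intro exI[of _ "ln 3 / c + real m + 1"] ballI)
    fix \<alpha> \<beta> :: real
    assume ab: "\<alpha> \<in> {0<..<1}" "\<beta> \<in> {0<..<1}"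
    define L where "L = \<bar>ln (min \<alpha> \<beta>)\<bar>"
    (* The least sample size with exp (- c n) \<le> min \<alpha> \<beta> / 3, shifted by m so that it also lies
       in the range where the exponential bounds hold. *)
    define n where "n = m + nat \<lceil>(L + ln 3) / c\<rceil>"
    have "m \<le> n"
      by (simp add: n_def)
    have min01: "0 < min \<alpha> \<beta>" "min \<alpha> \<beta> < 1"
      using ab by auto
    have nonneg: "0 \<le> (L + ln 3) / c"
      using assms(1) by (auto simp: L_def)
    have "real n = real m + real_of_int \<lceil>(L + ln 3) / c\<rceil>"
      using nonneg by (simp add: n_def)
    then have n_bounds: "(L + ln 3) / c \<le> real n" "real n \<le> real m + (L + ln 3) / c + 1"
      using add_increasing[OF of_nat_0_le_iff[of m] le_of_int_ceiling[of "(L + ln 3) / c"]]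
        of_int_ceiling_le_add_one[of "(L + ln 3) / c"]
      by (simp_all only: add.assoc add_left_mono)
    from n_bounds(1) have "- (c * real n) \<le> - L - ln 3"
      using assms(1) by (simp add: field_simps)
    also have "\<dots> = ln (min \<alpha> \<beta> / 3)"
      using ln_less_zero[OF min01] ln_divide_pos[OF min01(1), of 3] by (simp add: L_def)
    finally have "exp (- (c * real n)) \<le> min \<alpha> \<beta> / 3"
      using min01 by (simp add: ln_ge_iff)
    then have "exp (- (c * real n)) \<le> \<alpha>/3" "exp (- (c * real n)) \<le> \<beta>/3"
      using min.cobounded1[of \<alpha> \<beta>] min.cobounded2[of \<alpha> \<beta>] by linarith+
    then have "nstar P0 P1 T (\<alpha>/3) (\<beta>/3) \<le> n"
      using order_trans[OF gt[OF \<open>m \<le> n\<close>]] order_trans[OF le[OF \<open>m \<le> n\<close>]] m \<open>m \<le> n\<close>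
      by (intro nstar_le[where \<kappa> = \<kappa>]) linarith+
    with n_bounds(2) show "real (nstar P0 P1 T (\<alpha>/3) (\<beta>/3)) \<le> \<bar>ln (min \<alpha> \<beta>)\<bar> / c + (ln 3 / c + real m + 1)"
      by (simp add: L_def add_divide_distrib)
  qed
qed

lemma asymp_le_unif_if_le_nstar_third:
  assumes reg: "vanishing_regime a b"
    and le: "\<And>k \<omega>. \<omega> \<in> W \<Longrightarrow> x k \<omega> \<le> nstar P0 P1 T (a k / 3) (b k / 3)"
  shows "asymp_le_unif W x (\<lambda>k. ereal \<bar>ln (min (a k) (b k))\<bar> / chernoff_C J0 J1 \<psi>0 \<psi>1)"
proof -
  obtain C where C: "0 < C" and CC: "chernoff_C J0 J1 \<psi>0 \<psi>1 = ereal C"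
    by (rule chernoff_C_pos_finite)
  show ?thesis
    unfolding CC
  proof (rule asymp_le_unif_if_affine_bound[OF C])
    show "0 < \<bar>ln (min (a k) (b k))\<bar>" for k
      using ln_less_zero[OF vanishing_regime_min(1,2)[OF reg], of k] by linarith
    show "filterlim (\<lambda>k. \<bar>ln (min (a k) (b k))\<bar>) at_top sequentially"
      by (rule vanishing_regime_min(3)[OF reg])
    fix c assume c: "0 < c" "c < C"
    then have "ereal c < chernoff_C J0 J1 \<psi>0 \<psi>1"
      by (simp add: CC)
    from nstar_third_le[OF c(1) this] obtain D where D: "\<forall>\<alpha>\<in>{0<..<1}. \<forall>\<beta>\<in>{0<..<1}.
        real (nstar P0 P1 T (\<alpha>/3) (\<beta>/3)) \<le> \<bar>ln (min \<alpha> \<beta>)\<bar> / c + D" ..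
    have "real (x k \<omega>) \<le> \<bar>ln (min (a k) (b k))\<bar> / c + D" if "\<omega> \<in> W" for k \<omega>
    proof -
      have "real (x k \<omega>) \<le> real (nstar P0 P1 T (a k / 3) (b k / 3))"
        using le[OF that, of k] by simp
      also have "\<dots> \<le> \<bar>ln (min (a k) (b k))\<bar> / c + D"
        by (rule D[rule_format, OF vanishing_regime_levels[OF reg]])
      finally show ?thesis .
    qed
    then show "\<exists>D. \<forall>k. \<forall>\<omega>\<in>W. real (x k \<omega>) \<le> \<bar>ln (min (a k) (b k))\<bar> / c + D"
      by (intro exI[of _ D] allI ballI)
  qed
qed

end

theorem mainTheorem5:
  fixes Omega :: "'w measure" and S :: "'s measure" and X :: "nat \<Rightarrow> 'w \<Rightarrow> 's"
    and Laws H0 H1 :: "(nat \<Rightarrow> 's) measure set" and P0 P1 :: "'w measure"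
    and T :: "nat \<Rightarrow> 'w \<Rightarrow> real"
    and I0 I1 J0 J1 :: real and \<psi>0 \<psi>1 :: "real \<Rightarrow> ereal"
  assumes "standing_assumptions Omega S X Laws H0 H1 P0 P1 T I0 I1 J0 J1 \<psi>0 \<psi>1"
  shows
    "(\<forall>\<alpha>\<in>{0<..<1}. \<forall>\<beta>\<in>{0<..<1}.
        \<forall>\<tau> d. (\<tau>, d) \<in> tilde_tests P0 P1 T \<alpha> \<beta> \<union> hat_tests P0 P1 T \<alpha> \<beta> \<union> check_tests P0 P1 T \<alpha> \<beta> \<longrightarrow>
          (\<forall>\<omega>\<in>space Omega. \<tau> \<omega> \<le> nstar P0 P1 T (\<alpha>/3) (\<beta>/3)))
     \<and>
     (\<forall>a b. vanishing_regime a b \<longrightarrow>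
        (\<forall>\<tau> d. (\<forall>k. (\<tau> k, d k) \<in> tilde_tests P0 P1 T (a k) (b k)) \<longrightarrow>
          asymp_le_unif (space Omega) \<tau>
            (\<lambda>k. ereal \<bar>ln (min (a k) (b k))\<bar> / chernoff_C J0 J1 \<psi>0 \<psi>1)) \<and>
        (\<forall>\<tau> d. (\<forall>k. (\<tau> k, d k) \<in> hat_tests P0 P1 T (a k) (b k)) \<longrightarrow>
          asymp_le_unif (space Omega) \<tau>
            (\<lambda>k. ereal \<bar>ln (min (a k) (b k))\<bar> / chernoff_C J0 J1 \<psi>0 \<psi>1)) \<and>
        (\<forall>\<tau> d. (\<forall>k. (\<tau> k, d k) \<in> check_tests P0 P1 T (a k) (b k)) \<longrightarrow>
          asymp_le_unif (space Omega) \<tau>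
            (\<lambda>k. ereal \<bar>ln (min (a k) (b k))\<bar> / chernoff_C J0 J1 \<psi>0 \<psi>1)))"
proof -
  interpret standing_assumptions Omega S X Laws H0 H1 P0 P1 T I0 I1 J0 J1 \<psi>0 \<psi>1
    by (rule assms)
  have asymp: "asymp_le_unif (space Omega) \<tau>
      (\<lambda>k. ereal \<bar>ln (min (a k) (b k))\<bar> / chernoff_C J0 J1 \<psi>0 \<psi>1)"
    if reg: "vanishing_regime a b"
      and tests: "\<And>k. \<exists>d. (\<tau> k, d) \<in> tilde_tests P0 P1 T (a k) (b k) \<union>
        hat_tests P0 P1 T (a k) (b k) \<union> check_tests P0 P1 T (a k) (b k)"
    for a b \<tau>
  proof (rule asymp_le_unif_if_le_nstar_third[OF reg])
    fix k \<omega>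
    show "\<tau> k \<omega> \<le> nstar P0 P1 T (a k / 3) (b k / 3)"
      using tests[of k] multistage_tau_le[OF vanishing_regime_levels[OF reg, of k]] by blast
  qed
  show ?thesis
  proof (intro conjI ballI allI impI)
    fix \<alpha> \<beta> \<tau> d \<omega>
    assume "\<alpha> \<in> {0<..<1}" "\<beta> \<in> {0<..<1}"
      and "(\<tau>, d) \<in> tilde_tests P0 P1 T \<alpha> \<beta> \<union> hat_tests P0 P1 T \<alpha> \<beta> \<union> check_tests P0 P1 T \<alpha> \<beta>"
    then show "\<tau> \<omega> \<le> nstar P0 P1 T (\<alpha>/3) (\<beta>/3)"
      by (rule multistage_tau_le)
  qed (rule asymp, assumption, blast)+
qed

end
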